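(* Let $n\geq 3$ and $m>l\geq 2$ be integers. Then every tree $T_n$ with $n$ vertices is $(K_m\cup K_l)$-good.
   Context: All graphs are finite, undirected and simple. $v(G)$ is the number of vertices of $G$; $\chi(G)$ is the chromatic number; the chromatic surplus $s(G)$ is the minimum, over all proper colorings of $V(G)$ with $\chi(G)$ colors, of the number of vertices in a smallest color class. $K_m\cup K_l$ is the disjoint union of the complete graphs $K_m$ and $K_l$. For graphs $G,H$, the Ramsey number $R(G,H)$ is the minimum integer $N$ such that any coloring of the edges of $K_N$ in red or blue yields a red copy of $G$ or a blue copy of $H$ (as a not necessarily induced subgraph). A connected graph $G$ with $v(G)\geq s(H)$ is called $H$-good if $R(G,H)=(v(G)-1)(\chi(H)-1)+s(H)$. *)

theory Defs
  imports "Graph_Theory.Graph_Theory"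
begin

text \<open>
  Finite simple undirected graphs are the symmetric, loop-free finite digraphs given by the locale
  predicate \<^const>\<open>pair_graph\<close>; an edge $uv$ is the pair of arcs $(u,v)$, $(v,u)$.
\<close>

definition complete_graph :: "nat \<Rightarrow> nat pair_pre_digraph" where
  "complete_graph n = \<lparr> pverts = {..<n}, parcs = {(u, v). u < n \<and> v < n \<and> u \<noteq> v} \<rparr>"

definition disjoint_union ::
  "'a pair_pre_digraph \<Rightarrow> 'b pair_pre_digraph \<Rightarrow> ('a + 'b) pair_pre_digraph" where
  "disjoint_union G H = \<lparr> pverts = pverts G <+> pverts H,
     parcs = map_prod Inl Inl ` parcs G \<union> map_prod Inr Inr ` parcs H \<rparr>"

text \<open>
  The library's \<^const>\<open>tree\<close> does not fit here: it forbids directed cycles, and in a symmetric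
  digraph the two arcs of a single edge already form one. The cycles of an undirected simple graph
  are the directed cycles of length at least 3.
\<close>

definition undirected_tree :: "'a pair_pre_digraph \<Rightarrow> bool" where
  "undirected_tree G \<longleftrightarrow> pair_graph G \<and> Digraph_Component.connected (with_proj G) \<and>
     \<not> (\<exists>p. pre_digraph.cycle (with_proj G) p \<and> length p \<ge> 3)"

definition proper_coloring :: "'a pair_pre_digraph \<Rightarrow> nat \<Rightarrow> ('a \<Rightarrow> nat) \<Rightarrow> bool" where
  "proper_coloring G k f \<longleftrightarrow>
     (\<forall>v \<in> pverts G. f v < k) \<and> (\<forall>(u, v) \<in> parcs G. f u \<noteq> f v)"

definition chromatic_number :: "'a pair_pre_digraph \<Rightarrow> nat" where
  "chromatic_number G = (LEAST k. \<exists>f. proper_coloring G k f)"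

definition smallest_class_size :: "'a pair_pre_digraph \<Rightarrow> nat \<Rightarrow> ('a \<Rightarrow> nat) \<Rightarrow> nat" where
  "smallest_class_size G k f = Min ((\<lambda>i. card {v \<in> pverts G. f v = i}) ` {..<k})"

definition chromatic_surplus :: "'a pair_pre_digraph \<Rightarrow> nat" where
  "chromatic_surplus G = (LEAST s. \<exists>f. proper_coloring G (chromatic_number G) f \<and>
     s = smallest_class_size G (chromatic_number G) f)"

text \<open>A copy of \<open>G\<close> in \<open>H\<close> is a not necessarily induced subgraph of \<open>H\<close> isomorphic to \<open>G\<close>.\<close>

definition has_copy :: "'a pair_pre_digraph \<Rightarrow> 'b pair_pre_digraph \<Rightarrow> bool" where
  "has_copy G H \<longleftrightarrow>
     (\<exists>K. subgraph (with_proj K) (with_proj H) \<and> digraph_iso (with_proj G) (with_proj K))"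

datatype color = Red | Blue

text \<open>
  Edge colorings act on unordered pairs, so both arcs of an edge get the same color; values of the
  coloring on sets that are not edges are irrelevant.
\<close>

definition color_subgraph ::
  "'a pair_pre_digraph \<Rightarrow> ('a set \<Rightarrow> color) \<Rightarrow> color \<Rightarrow> 'a pair_pre_digraph" where
  "color_subgraph K c x =
     \<lparr> pverts = pverts K, parcs = {(u, v). (u, v) \<in> parcs K \<and> c {u, v} = x} \<rparr>"

definition ramsey_arrows :: "nat \<Rightarrow> 'a pair_pre_digraph \<Rightarrow> 'b pair_pre_digraph \<Rightarrow> bool" where
  "ramsey_arrows N G H \<longleftrightarrow> (\<forall>c. has_copy G (color_subgraph (complete_graph N) c Red) \<or>
     has_copy H (color_subgraph (complete_graph N) c Blue))"

definition ramsey_number :: "'a pair_pre_digraph \<Rightarrow> 'b pair_pre_digraph \<Rightarrow> nat" where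
  "ramsey_number G H = (LEAST N. ramsey_arrows N G H)"

text \<open>
  The subtractions are not truncated for nonempty \<open>H\<close>: a connected \<open>G\<close> is nonempty in
  the library's sense.
\<close>

definition is_good :: "'b pair_pre_digraph \<Rightarrow> 'a pair_pre_digraph \<Rightarrow> bool" where
  "is_good H G \<longleftrightarrow> pair_graph G \<and> pair_graph H \<and>
     Digraph_Component.connected (with_proj G) \<and> card (pverts G) \<ge> chromatic_surplus H \<and>
     ramsey_number G H = (card (pverts G) - 1) * (chromatic_number H - 1) + chromatic_surplus H"

end

theory Submission
  imports Defs
begin

text \<open>
  Since $m > l$, the graph $H = K_m \<union> K_l$ has chromatic number $m$ and surplus $1$, so with $n$ the
  number of vertices of $T$ the claim is $R(T, H) = (n-1)(m-1)+1$. The lower bound is the usual one: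
  $m-1$ disjoint red cliques on $n-1$ vertices each, with all other edges blue, contain neither a
  red $T$ nor a blue $K_m$.

  For the upper bound, a blue clique is an independent set of the red graph. As $l \<le> m-1$, it is
  enough to find, with $k = m-1$, two disjoint independent sets of sizes $k+1$ and $k$ in every graph
  without a copy of $T$ that has more than $(n-1)k$ vertices
  (\<open>tree_free_disjoint_indep_pair\<close>). Everything rests on one observation, applied with
  $T' = T - x$ for a leaf $x$: a maximal independent set $B$ dominates the other vertices, so a copy
  of $T'$ outside $B$ extends to a copy of $T$ whose new leaf is in $B$. Hence deleting $B$ leaves
  a graph without a copy of $T'$ (\<open>embeds_add_leaf\<close>).

  By induction on $T$, this first gives Chvatal's theorem: one independent set of size $k+1$. The
  pair is found by the same induction. If some maximal independent set has at most $k$ vertices,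
  then deleting it leaves more than $(n-2)k$ vertices, and the pair exists there already. Otherwise
  every maximal independent set has at least $k+1$ vertices. Let $A$ be one, of size $k+1+d$.
  Outside $A$, Chvatal's theorem for $T'$ gives an independent set $C$ of size $k-d$. It
  extends to a maximal independent set, so also to an independent set $B$ of size exactly $k$. The at
  most $d$ vertices that this adds are the only ones that $B$ can share with $A$, so at least $k+1$
  vertices of $A$ remain.

  The induction cannot start below $n = 3$, because the claim is false for $n = 2$: an edgeless graph
  on $k+1$ vertices has no such pair. For $n = 3$ a dominating set of size at most $k$ is excluded by
  the pigeonhole principle: two of the more than $k$ vertices outside have a common neighbour inside,
  and this is a path on three vertices.
\<close>

section \<open>Trees grown leaf by leaf\<close>

text \<open>
  Trees in the form that the inductions need: a vertex set and a symmetric set of arcs, with the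
  deletion of a leaf built into the construction.
\<close>

inductive grown_tree :: "'a set \<Rightarrow> ('a \<times> 'a) set \<Rightarrow> bool" where
  single: "grown_tree {v} {}"
| add_leaf: "grown_tree V E \<Longrightarrow> y \<in> V \<Longrightarrow> x \<notin> V \<Longrightarrow>
    grown_tree (insert x V) (E \<union> {(x, y), (y, x)})"

lemma grown_tree_finite: "grown_tree V E \<Longrightarrow> finite V"
  by (induction rule: grown_tree.induct) auto

lemma grown_tree_nonempty: "grown_tree V E \<Longrightarrow> V \<noteq> {}"
  by (induction rule: grown_tree.induct) auto

lemma grown_tree_card_pos: "grown_tree V E \<Longrightarrow> 1 \<le> card V"
  by (simp add: Suc_le_eq card_gt_0_iff grown_tree_finite grown_tree_nonempty)

lemma grown_tree_arcs_in: "grown_tree V E \<Longrightarrow> E \<subseteq> V \<times> V"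
  by (induction rule: grown_tree.induct) auto

lemma grown_tree_sym: "grown_tree V E \<Longrightarrow> sym E"
  by (induction rule: grown_tree.induct) (auto simp: sym_def)

lemma grown_tree_no_loop: "grown_tree V E \<Longrightarrow> (a, a) \<notin> E"
  by (induction rule: grown_tree.induct) auto

lemma pawalk_verts_snoc:
  "pcas u p w \<Longrightarrow> pawalk_verts u (p @ [(w, x)]) = pawalk_verts u p @ [x]"
  by (induction p arbitrary: u) auto

lemma pcas_snoc: "pcas u (p @ [(w, x)]) z \<longleftrightarrow> pcas u p w \<and> x = z"
  by (induction p arbitrary: u) auto

lemma grown_tree_path:
  assumes "grown_tree V E" "u \<in> V" "v \<in> V"
  shows "\<exists>p. pcas u p v \<and> set p \<subseteq> E \<and> distinct (pawalk_verts u p) \<and> set (pawalk_verts u p) \<subseteq> V"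
  using assms
proof (induction arbitrary: u v rule: grown_tree.induct)
  case (single w)
  then show ?case by (intro exI[of _ "[]"]) auto
next
  case (add_leaf V E y x)
  consider "u = x" "v = x" | "u = x" "v \<in> V" | "u \<in> V" "v = x" | "u \<in> V" "v \<in> V"
    using add_leaf.prems by auto
  then show ?case
  proof cases
    case 1
    then show ?thesis by (intro exI[of _ "[]"]) auto
  next
    case 2
    obtain p where "pcas y p v" "set p \<subseteq> E" "distinct (pawalk_verts y p)"
        "set (pawalk_verts y p) \<subseteq> V"
      using add_leaf.IH[OF add_leaf.hyps(2) 2(2)] by blast
    then show ?thesis using 2 add_leaf.hyps(3) by (intro exI[of _ "(x, y) # p"]) auto
  next
    case 3
    obtain p where "pcas u p y" "set p \<subseteq> E" "distinct (pawalk_verts u p)"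
        "set (pawalk_verts u p) \<subseteq> V"
      using add_leaf.IH[OF 3(1) add_leaf.hyps(2)] by blast
    then show ?thesis using 3 add_leaf.hyps(3)
      by (intro exI[of _ "p @ [(y, x)]"]) (auto simp: pawalk_verts_snoc pcas_snoc)
  next
    case 4
    then obtain p where "pcas u p v" "set p \<subseteq> E" "distinct (pawalk_verts u p)"
        "set (pawalk_verts u p) \<subseteq> V"
      using add_leaf.IH by blast
    then show ?thesis by blast
  qed
qed

text \<open>
  A maximal grown subtree spans, because a connected graph has an arc that leaves any proper
  nonempty vertex set. It contains every arc as well: an arc outside it would close a
  cycle with the path in the subtree between its ends.
\<close>

lemma undirected_tree_grown:
  assumes "undirected_tree T"
  shows "grown_tree (pverts T) (parcs T)"
proof -
  have pg: "pair_graph T" and conn: "Digraph_Component.connected (with_proj T)"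
    and nocyc: "\<not> (\<exists>p. pre_digraph.cycle (with_proj T) p \<and> length p \<ge> 3)"
    using assms by (auto simp: undirected_tree_def)
  interpret pair_graph T by (rule pg)
  have sc: "strongly_connected (with_proj T)"
    using symmetric_connected_imp_strongly_connected[OF _ conn] sym_arcs by blast
  let ?S = "{V'. V' \<subseteq> pverts T \<and> (\<exists>E'\<subseteq>parcs T. grown_tree V' E')}"
  obtain r where r: "r \<in> pverts T"
    using sc by (auto simp: strongly_connected_def)
  have "{r} \<in> ?S" using r grown_tree.single[of r] by auto
  moreover have "finite ?S"
    by (rule finite_subset[of _ "Pow (pverts T)"]) auto
  ultimately obtain V where V: "V \<in> ?S" "r \<in> V" and Vmax: "\<And>V'. V' \<in> ?S \<Longrightarrow> V \<subseteq> V' \<Longrightarrow> V = V'"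
    using finite_has_maximal2[of ?S "{r}"] by auto
  then obtain E where E: "E \<subseteq> parcs T" "grown_tree V E" by auto
  have closed: "b \<in> V" if "a \<in> V" "(a, b) \<in> parcs T" for a b
  proof (rule ccontr)
    assume "b \<notin> V"
    then have "grown_tree (insert b V) (E \<union> {(b, a), (a, b)})"
      using grown_tree.add_leaf[OF E(2) that(1)] by blast
    moreover have "b \<in> pverts T" using that in_arcsD2 by auto
    moreover have "E \<union> {(b, a), (a, b)} \<subseteq> parcs T"
      using E that arcs_symmetric by auto
    moreover have "insert b V \<subseteq> pverts T" using V \<open>b \<in> pverts T\<close> by auto
    ultimately have "insert b V \<in> ?S" by blast
    then show False using Vmax[of "insert b V"] \<open>b \<notin> V\<close> by auto
  qed
  have "v \<in> V" if "v \<in> pverts T" for v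
  proof -
    have "r \<rightarrow>\<^sup>*\<^bsub>with_proj T\<^esub> v"
      using sc r that by (auto simp: strongly_connected_def)
    then have "(r, v) \<in> (parcs T)\<^sup>*" by (auto dest: reachable_rtranclI)
    then show ?thesis
      by (induction rule: rtrancl_induct) (auto simp: V(2) closed)
  qed
  then have Veq: "V = pverts T" using V by auto
  have "parcs T \<subseteq> E"
  proof (rule ccontr)
    assume "\<not> parcs T \<subseteq> E"
    then obtain a b where ab: "(a, b) \<in> parcs T" "(a, b) \<notin> E" by auto
    have mem: "a \<in> V" "b \<in> V" using ab in_arcsD1 in_arcsD2 Veq by auto
    obtain p where p: "pcas b p a" "set p \<subseteq> E" "distinct (pawalk_verts b p)"
      using grown_tree_path[OF E(2) mem(2,1)] by blast
    have "a \<noteq> b" using ab no_loops' by blast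
    \<comment> \<open>The cycle has to consist of more than the two arcs of one edge.\<close>
    have "length p \<ge> 2"
    proof (rule ccontr)
      assume "\<not> length p \<ge> 2"
      then consider "p = []" | e where "p = [e]"
        by (cases p; cases "tl p") auto
      then show False
      proof cases
        case 1
        then show False using p \<open>a \<noteq> b\<close> by simp
      next
        case 2
        then have "(b, a) \<in> E" using p by (cases e) auto
        then show False using ab grown_tree_sym[OF E(2)] by (auto dest: symD)
      qed
    qed
    moreover have "cycle ((a, b) # p)"
      unfolding cycle_def awalk_def
      using p E ab mem Veq by (intro exI[of _ a]) auto
    ultimately show False using nocyc by (auto intro!: exI[of _ "(a, b) # p"])
  qed
  then show ?thesis using E Veq by auto
qed

section \<open>Embeddings and independent sets\<close>

definition embeds :: "'a set \<Rightarrow> ('a \<times> 'a) set \<Rightarrow> 'b set \<Rightarrow> ('b \<times> 'b) set \<Rightarrow> bool" where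
  "embeds V E W R \<longleftrightarrow>
     (\<exists>f. inj_on f V \<and> f ` V \<subseteq> W \<and> (\<forall>a b. (a, b) \<in> E \<longrightarrow> (f a, f b) \<in> R))"

definition indep :: "('b \<times> 'b) set \<Rightarrow> 'b set \<Rightarrow> bool" where
  "indep R A \<longleftrightarrow> (\<forall>a \<in> A. \<forall>b \<in> A. (a, b) \<notin> R)"

definition dominating :: "('b \<times> 'b) set \<Rightarrow> 'b set \<Rightarrow> 'b set \<Rightarrow> bool" where
  "dominating R W B \<longleftrightarrow> B \<subseteq> W \<and> (\<forall>w \<in> W - B. \<exists>b \<in> B. (w, b) \<in> R)"

lemma indep_subset: "indep R A \<Longrightarrow> B \<subseteq> A \<Longrightarrow> indep R B"
  by (auto simp: indep_def)

text \<open>A maximal independent set dominates: an undominated vertex could be added to it.\<close>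

lemma indep_extend_dominating:
  assumes "finite W" "sym R" "irrefl R" "C \<subseteq> W" "indep R C"
  obtains B where "C \<subseteq> B" "indep R B" "dominating R W B"
proof -
  let ?S = "{B. B \<subseteq> W \<and> indep R B}"
  have "finite ?S" by (rule finite_subset[of _ "Pow W"]) (use assms in auto)
  then obtain B where B: "B \<in> ?S" "C \<subseteq> B" and max: "\<And>B'. B' \<in> ?S \<Longrightarrow> B \<subseteq> B' \<Longrightarrow> B = B'"
    using finite_has_maximal2[of ?S C] assms(4,5) by auto
  have "\<exists>b \<in> B. (w, b) \<in> R" if w: "w \<in> W - B" for w
  proof (rule ccontr)
    assume "\<not> (\<exists>b \<in> B. (w, b) \<in> R)"
    then have "indep R (insert w B)"
      using B assms(2,3) by (auto simp: indep_def irrefl_def dest: symD)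
    then have "B = insert w B" using max[of "insert w B"] B w by auto
    then show False using w by auto
  qed
  then show thesis using that[of B] B by (auto simp: dominating_def)
qed

text \<open>
  The image of \<open>y\<close> lies outside \<open>B\<close>, so it has a neighbour in \<open>B\<close>; this neighbour is not
  yet used and serves as the image of the leaf \<open>x\<close>.
\<close>

lemma embeds_add_leaf:
  assumes "embeds V E (W - B) R" "dominating R W B" "sym R"
    and "E \<subseteq> V \<times> V" "y \<in> V" "x \<notin> V"
  shows "embeds (insert x V) (E \<union> {(x, y), (y, x)}) W R"
proof -
  obtain f where f: "inj_on f V" "f ` V \<subseteq> W - B" "\<And>a b. (a, b) \<in> E \<Longrightarrow> (f a, f b) \<in> R"
    using assms(1) by (auto simp: embeds_def)
  obtain b where b: "b \<in> B" "(f y, b) \<in> R"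
    using assms(2,5) f(2) unfolding dominating_def by blast
  have "inj_on (f(x := b)) (insert x V)"
    using f b assms(6) by (auto simp: inj_on_def image_subset_iff)
  moreover have "(f(x := b)) ` insert x V \<subseteq> W"
    using f b assms(2,6) by (auto simp: dominating_def)
  moreover have "((f(x := b)) c, (f(x := b)) d) \<in> R" if "(c, d) \<in> E \<union> {(x, y), (y, x)}" for c d
    using that f(3) b assms(3-6) by (auto dest: symD)
  ultimately show ?thesis unfolding embeds_def by (intro exI[of _ "f(x := b)"]) blast
qed

text \<open>
  Chvatal's theorem, without colors. Each leaf of the tree accounts for one maximal independent set:
  if it has at most \<open>k\<close> vertices, then deleting it leaves enough vertices to continue with the
  tree without that leaf.
\<close>

lemma chvatal_tree_independent:
  assumes "grown_tree V E" "finite W" "sym R" "irrefl R"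
    and "(card V - 1) * k < card W" "\<not> embeds V E W R"
  obtains I where "I \<subseteq> W" "indep R I" "card I = Suc k"
proof -
  have "\<exists>I\<subseteq>W. indep R I \<and> card I = Suc k"
    using assms
  proof (induction arbitrary: W rule: grown_tree.induct)
    case (single v)
    then obtain w where "w \<in> W" by fastforce
    then have "embeds {v} {} W R"
      unfolding embeds_def by (intro exI[of _ "\<lambda>_. w"]) auto
    then show ?case using single by blast
  next
    case (add_leaf V E y x)
    obtain B where B: "indep R B" "dominating R W B"
      using indep_extend_dominating[of W R "{}"] add_leaf.prems by (auto simp: indep_def)
    have BW: "B \<subseteq> W" "finite B" using B add_leaf.prems by (auto simp: dominating_def finite_subset)
    show ?case
    proof (cases "Suc k \<le> card B")
      case True
      then obtain I where "I \<subseteq> B" "card I = Suc k"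
        using obtain_subset_with_card_n by metis
      then show ?thesis using B BW indep_subset by blast
    next
      case False
      have "card V \<ge> 1" by (rule grown_tree_card_pos[OF add_leaf.hyps(1)])
      then have "(card (insert x V) - 1) * k = (card V - 1) * k + k"
        using add_leaf.hyps grown_tree_finite[OF add_leaf.hyps(1)]
        by (cases "card V") auto
      then have "(card V - 1) * k < card (W - B)"
        using False add_leaf.prems BW by (simp add: card_Diff_subset)
      moreover have "\<not> embeds V E (W - B) R"
        using embeds_add_leaf[OF _ B(2) _ _ add_leaf.hyps(2,3)] grown_tree_arcs_in[OF add_leaf.hyps(1)]
          add_leaf.prems by blast
      ultimately obtain I where "I \<subseteq> W - B" "indep R I" "card I = Suc k"
        using add_leaf.IH[of "W - B"] add_leaf.prems by auto
      then show ?thesis by blast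
    qed
  qed
  then show thesis using that by blast
qed

text \<open>
  By the pigeonhole principle, two vertices outside \<open>B\<close> have a common neighbour in \<open>B\<close>. That
  neighbour becomes the middle vertex \<open>y\<close> of the path.
\<close>

lemma small_dominating_embeds_three_vertex_tree:
  assumes "grown_tree V E" "card V = 2" "y \<in> V" "x \<notin> V" "sym R"
    and "dominating R W B" "finite W" "card B < card (W - B)"
  shows "embeds (insert x V) (E \<union> {(x, y), (y, x)}) W R"
proof -
  obtain z where z: "V = {y, z}" "y \<noteq> z"
    using assms(2,3) by (auto simp: card_2_iff)
  have EV: "E \<subseteq> {(y, z), (z, y)}"
    using grown_tree_arcs_in[OF assms(1)] grown_tree_no_loop[OF assms(1)] z by auto
  obtain g where g: "\<And>w. w \<in> W - B \<Longrightarrow> g w \<in> B \<and> (w, g w) \<in> R"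
    using assms(6) unfolding dominating_def by metis
  have "finite B" using assms(6,7) by (auto simp: dominating_def finite_subset)
  then have "\<not> inj_on g (W - B)"
    using card_inj_on_le[of g "W - B" B] g assms(8) by auto
  then obtain w1 w2 where w: "w1 \<in> W - B" "w2 \<in> W - B" "w1 \<noteq> w2" "g w1 = g w2"
    by (auto simp: inj_on_def)
  define f where "f = (\<lambda>a. if a = x then w1 else if a = z then w2 else g w1)"
  have xyz: "x \<noteq> y" "x \<noteq> z" using assms(4) z by auto
  have g12: "g w1 \<in> B" "(w1, g w1) \<in> R" "(w2, g w1) \<in> R"
    using g[of w1] g[of w2] w by auto
  have BW: "B \<subseteq> W" using assms(6) by (auto simp: dominating_def)
  have "inj_on f (insert x V)" "f ` insert x V \<subseteq> W"
    using w g12 xyz z BW by (auto simp: f_def inj_on_def)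
  moreover have "(f a, f b) \<in> R" if "(a, b) \<in> E \<union> {(x, y), (y, x)}" for a b
    using that EV xyz z g12 assms(5) by (auto simp: f_def dest: symD)
  ultimately show ?thesis unfolding embeds_def by (intro exI[of _ f]) blast
qed

text \<open>The bookkeeping that allows an induction on the tree to continue outside a small dominating set.\<close>

lemma small_dominating_leaves_tree_free:
  fixes k :: nat
  assumes "grown_tree V E" "y \<in> V" "x \<notin> V" "finite W" "sym R"
    and "card V * k < card W" "\<not> embeds (insert x V) (E \<union> {(x, y), (y, x)}) W R"
    and "dominating R W B" "card B \<le> k"
  shows "(card V - 1) * k < card (W - B)" "\<not> embeds V E (W - B) R"
proof -
  have "card V \<ge> 1" by (rule grown_tree_card_pos[OF assms(1)])
  then have "card V * k = (card V - 1) * k + k"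
    by (cases "card V") auto
  moreover have "B \<subseteq> W" "finite B" using assms by (auto simp: dominating_def finite_subset)
  ultimately show "(card V - 1) * k < card (W - B)"
    using assms by (simp add: card_Diff_subset)
  show "\<not> embeds V E (W - B) R"
    using embeds_add_leaf[OF _ assms(8,5) grown_tree_arcs_in[OF assms(1)] assms(2,3)] assms(7) by blast
qed

text \<open>
  The surplus \<open>d\<close> of a maximal independent set \<open>A\<close> over \<open>k + 1\<close> vertices makes up for a second
  independent set \<open>C\<close>, disjoint from \<open>A\<close>, that is \<open>d\<close> vertices short of \<open>k\<close>: since no
  maximal independent set is small, \<open>C\<close> can be completed to \<open>k\<close> vertices, at the cost of at
  most \<open>d\<close> vertices of \<open>A\<close>.
\<close>

lemma disjoint_indep_pair_if_large_dominating:
  assumes tree: "grown_tree V E" "y \<in> V" "x \<notin> V" "card V \<ge> 2"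
    and R: "finite W" "sym R" "irrefl R"
    and large: "card V * k < card W"
    and free: "\<not> embeds (insert x V) (E \<union> {(x, y), (y, x)}) W R"
    and dom: "\<And>B. indep R B \<Longrightarrow> dominating R W B \<Longrightarrow> k < card B"
  shows "\<exists>A B. A \<subseteq> W \<and> B \<subseteq> W \<and> A \<inter> B = {} \<and> indep R A \<and> indep R B \<and>
    card A = Suc k \<and> card B = k"
proof -
  obtain A where A: "indep R A" "dominating R W A"
    using indep_extend_dominating[OF R, of "{}"] by (auto simp: indep_def)
  have AW: "A \<subseteq> W" "finite A" using A R by (auto simp: dominating_def finite_subset)
  define d where "d = card A - Suc k"
  have cA: "card A = Suc k + d" using dom[OF A] by (simp add: d_def)
  obtain C where C: "C \<subseteq> W - A" "indep R C" "card C = k - d"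
  proof (cases "d < k")
    case False
    then show thesis using that[of "{}"] by (auto simp: indep_def)
  next
    case True
    then obtain q where q: "k = d + Suc q" by (metis add_Suc_right less_imp_Suc_add)
    obtain p where p: "card V = Suc (Suc p)"
      using tree(4) by (metis Suc_le_D numeral_2_eq_2 Suc_le_mono)
    \<comment> \<open>With \<open>card V = p + 2\<close>, the number of vertices outside \<open>A\<close> is at least
      \<open>(p + 1) * k - d = (p + 1) * q + p * (d + 1) + 1\<close>.\<close>
    have "(card V - 1) * q < card (W - A)"
      using large cA AW R p q by (simp add: card_Diff_subset algebra_simps)
    moreover have "\<not> embeds V E (W - A) R"
      using embeds_add_leaf[OF _ A(2) R(2) grown_tree_arcs_in[OF tree(1)] tree(2,3)] free by blast
    ultimately obtain C where "C \<subseteq> W - A" "indep R C" "card C = Suc q"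
      using chvatal_tree_independent[OF tree(1) _ R(2,3)] R(1) by (metis finite_Diff)
    then show thesis using that[of C] q by simp
  qed
  have "C \<subseteq> W" using C by auto
  then obtain B0 where B0: "C \<subseteq> B0" "indep R B0" "dominating R W B0"
    using indep_extend_dominating[OF R _ C(2)] by blast
  have B0W: "B0 \<subseteq> W" "finite B0" using B0 R by (auto simp: dominating_def finite_subset)
  obtain B where B: "C \<subseteq> B" "B \<subseteq> B0" "card B = k"
    using exists_subset_between[of C k B0] C(3) dom[OF B0(2,3)] B0 B0W by auto
  have finB: "finite B" using B B0W finite_subset by blast
  have "A \<inter> B \<subseteq> B - C" using C by auto
  then have "card (A \<inter> B) \<le> card (B - C)" using finB by (intro card_mono) auto
  also have "\<dots> = k - (k - d)"
    using B C finB by (simp add: card_Diff_subset finite_subset)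
  finally have "card (A \<inter> B) \<le> d" by simp
  then have "Suc k \<le> card (A - B)"
    using cA AW by (simp add: card_Diff_subset_Int)
  then obtain A' where "A' \<subseteq> A - B" "card A' = Suc k"
    using obtain_subset_with_card_n by metis
  moreover have "indep R A'" "indep R B"
    using \<open>A' \<subseteq> A - B\<close> A B B0 indep_subset by blast+
  ultimately show ?thesis
    using AW B B0W by (intro exI[of _ A'] exI[of _ B]) auto
qed

text \<open>
  Induction on the tree; a small dominating set is deleted, or, for a tree on three vertices,
  impossible.
\<close>

lemma tree_free_disjoint_indep_pair:
  assumes "grown_tree V E" "card V \<ge> 3" "finite W" "sym R" "irrefl R"
    and "(card V - 1) * k < card W" "\<not> embeds V E W R"
  shows "\<exists>A B. A \<subseteq> W \<and> B \<subseteq> W \<and> A \<inter> B = {} \<and> indep R A \<and> indep R B \<and>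
    card A = Suc k \<and> card B = k"
  using assms
proof (induction arbitrary: W rule: grown_tree.induct)
  case (single v)
  then show ?case by simp
next
  case (add_leaf V E y x)
  have cV: "card (insert x V) = Suc (card V)"
    using add_leaf.hyps grown_tree_finite[OF add_leaf.hyps(1)] by simp
  have large: "card V * k < card W" using add_leaf.prems cV by simp
  show ?case
  proof (cases "\<exists>B. dominating R W B \<and> card B \<le> k")
    case False
    moreover have "2 \<le> card V" using add_leaf.prems(1) cV by simp
    ultimately show ?thesis
      by (intro disjoint_indep_pair_if_large_dominating[OF add_leaf.hyps _ add_leaf.prems(2-4) large
            add_leaf.prems(6)]) (auto simp: not_le)
  next
    case True
    then obtain B where B: "dominating R W B" "card B \<le> k" by blast
    note sd = small_dominating_leaves_tree_free[OF add_leaf.hyps add_leaf.prems(2,3) large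
        add_leaf.prems(6) B]
    show ?thesis
    proof (cases "card V \<ge> 3")
      case True
      then obtain A B' where "A \<subseteq> W - B" "B' \<subseteq> W - B" "A \<inter> B' = {}" "indep R A" "indep R B'"
          "card A = Suc k" "card B' = k"
        using add_leaf.IH[of "W - B"] sd add_leaf.prems by blast
      then show ?thesis by blast
    next
      case False
      then have c2: "card V = 2" using cV add_leaf.prems by simp
      then have "card B < card (W - B)" using sd(1) B by simp
      then have False
        using small_dominating_embeds_three_vertex_tree[OF add_leaf.hyps(1) c2 add_leaf.hyps(2,3)] B add_leaf.prems
        by blast
      then show ?thesis ..
    qed
  qed
qed

section \<open>Copies as embeddings\<close>

text \<open>
  In a digraph whose arcs are pairs of vertices, the arc map of an isomorphism is determined by its
  vertex map.
\<close>

lemma has_copy_iff_embeds: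
  assumes "pair_wf_digraph G" "pair_wf_digraph H"
  shows "has_copy G H \<longleftrightarrow> embeds (pverts G) (parcs G) (pverts H) (parcs H)"
proof
  assume "has_copy G H"
  then obtain K h where K: "subgraph (with_proj K) (with_proj H)"
    and h: "pre_digraph.digraph_isomorphism (with_proj G) h" and eq: "with_proj K = app_iso h (with_proj G)"
    by (auto simp: has_copy_def digraph_iso_def)
  have t: "iso_tail h = fst" "iso_head h = snd"
    using eq by (metis tail_app_iso with_proj_simps(4), metis head_app_iso with_proj_simps(5))
  have v: "pverts K = iso_verts h ` pverts G" "parcs K = iso_arcs h ` parcs G"
    using eq by (metis verts_app_iso with_proj_simps(1), metis arcs_app_iso with_proj_simps(2))
  have "iso_arcs h (a, b) = (iso_verts h a, iso_verts h b)" if "(a, b) \<in> parcs G" for a b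
    using h that t unfolding pre_digraph.digraph_isomorphism_def by (auto simp: prod_eq_iff)
  moreover have "parcs K \<subseteq> parcs H" "pverts K \<subseteq> pverts H" using K by (auto simp: subgraph_def)
  moreover have "inj_on (iso_verts h) (pverts G)"
    using h unfolding pre_digraph.digraph_isomorphism_def by simp
  ultimately show "embeds (pverts G) (parcs G) (pverts H) (parcs H)"
    unfolding embeds_def v by (intro exI[of _ "iso_verts h"]) (metis image_eqI subset_iff)
next
  assume "embeds (pverts G) (parcs G) (pverts H) (parcs H)"
  then obtain f where f: "inj_on f (pverts G)" "f ` pverts G \<subseteq> pverts H"
      "\<And>a b. (a, b) \<in> parcs G \<Longrightarrow> (f a, f b) \<in> parcs H"
    by (auto simp: embeds_def)
  interpret G: pair_wf_digraph G by fact
  define K where "K = \<lparr> pverts = f ` pverts G, parcs = map_prod f f ` parcs G \<rparr>"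
  define h where "h = \<lparr> iso_verts = f, iso_arcs = map_prod f f, iso_head = snd, iso_tail = fst \<rparr>"
  have "parcs G \<subseteq> pverts G \<times> pverts G"
    using G.in_arcsD1 G.in_arcsD2 by auto
  then have "inj_on (map_prod f f) (parcs G)"
    using f(1) by (intro inj_on_subset[OF map_prod_inj_on]) auto
  then have "pre_digraph.digraph_isomorphism (with_proj G) h"
    using f(1) assms(1) unfolding pre_digraph.digraph_isomorphism_def
    by (auto simp: h_def wf_digraph_wp_iff)
  moreover have "with_proj K = app_iso h (with_proj G)"
    by (simp add: app_iso_def h_def K_def with_proj_def)
  moreover have "subgraph (with_proj K) (with_proj H)"
    unfolding subgraph_def using f assms(2) G.in_arcsD1 G.in_arcsD2
    by (auto simp: K_def wf_digraph_wp_iff pair_wf_digraph_def)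
  ultimately show "has_copy G H" unfolding has_copy_def digraph_iso_def by blast
qed

lemma pair_graph_imp_wf: "pair_graph G \<Longrightarrow> pair_wf_digraph G"
  by (simp add: pair_graph_def pair_digraph_def pair_fin_digraph_def)

lemma pair_graph_complete_graph: "pair_graph (complete_graph n)"
proof
  show "finite (parcs (complete_graph n))"
    by (rule finite_subset[of _ "{..<n} \<times> {..<n}"]) (auto simp: complete_graph_def)
qed (auto simp: complete_graph_def symmetric_def sym_def)

lemma pair_graph_disjoint_union:
  assumes "pair_graph G" "pair_graph H"
  shows "pair_graph (disjoint_union G H)"
proof -
  interpret G: pair_graph G by fact
  interpret H: pair_graph H by fact
  show ?thesis
  proof
    show "symmetric (with_proj (disjoint_union G H))"
      using G.arcs_symmetric H.arcs_symmetric
      by (force simp: symmetric_def sym_def disjoint_union_def)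
  qed (auto simp: disjoint_union_def dest: G.in_arcsD1 G.in_arcsD2 H.in_arcsD1 H.in_arcsD2
        G.no_loops' H.no_loops')
qed

lemma pair_wf_color_subgraph:
  assumes "pair_wf_digraph K"
  shows "pair_wf_digraph (color_subgraph K c x)"
proof -
  interpret K: pair_wf_digraph K by fact
  show ?thesis by unfold_locales (auto simp: color_subgraph_def dest: K.in_arcsD1 K.in_arcsD2)
qed

abbreviation two_cliques :: "nat \<Rightarrow> nat \<Rightarrow> (nat + nat) pair_pre_digraph" where
  "two_cliques m l \<equiv> disjoint_union (complete_graph m) (complete_graph l)"

section \<open>Chromatic number and surplus of two disjoint cliques\<close>

text \<open>
  The larger clique alone decides everything: it needs \<open>m\<close> colors, and with exactly \<open>m\<close> colors it
  meets every class.
\<close>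

lemma proper_coloring_two_cliques_inj:
  assumes "proper_coloring (two_cliques m l) k f"
  shows "inj_on (\<lambda>i. f (Inl i)) {..<m}" "(\<lambda>i. f (Inl i)) ` {..<m} \<subseteq> {..<k}"
proof -
  have "f (Inl i) \<noteq> f (Inl j)" if "i < m" "j < m" "i \<noteq> j" for i j
  proof -
    have "(Inl i, Inl j) \<in> parcs (two_cliques m l)"
      using that by (force simp: disjoint_union_def complete_graph_def)
    then show ?thesis using assms by (auto simp: proper_coloring_def)
  qed
  then show "inj_on (\<lambda>i. f (Inl i)) {..<m}" by (auto simp: inj_on_def)
  show "(\<lambda>i. f (Inl i)) ` {..<m} \<subseteq> {..<k}"
    using assms by (auto simp: proper_coloring_def disjoint_union_def complete_graph_def)
qed

lemma proper_coloring_two_cliques: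
  assumes "l \<le> m"
  shows "proper_coloring (two_cliques m l) m (case_sum id id)"
  using assms by (auto simp: proper_coloring_def disjoint_union_def complete_graph_def)

lemma chromatic_number_two_cliques:
  assumes "l \<le> m"
  shows "chromatic_number (two_cliques m l) = m"
  unfolding chromatic_number_def
proof (rule Least_equality)
  show "\<exists>f. proper_coloring (two_cliques m l) m f"
    using proper_coloring_two_cliques[OF assms] by blast
next
  fix k assume "\<exists>f. proper_coloring (two_cliques m l) k f"
  then obtain f where "proper_coloring (two_cliques m l) k f" by blast
  from proper_coloring_two_cliques_inj[OF this] show "m \<le> k"
    using card_inj_on_le[of _ "{..<m}" "{..<k}"] by simp
qed

lemma chromatic_surplus_two_cliques:
  assumes "l < m"
  shows "chromatic_surplus (two_cliques m l) = 1"
proof -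
  let ?H = "two_cliques m l"
  have chi: "chromatic_number ?H = m" using assms by (simp add: chromatic_number_two_cliques)
  have fin: "finite (pverts ?H)" by (simp add: disjoint_union_def complete_graph_def)
  have ge: "1 \<le> smallest_class_size ?H m f" if pc: "proper_coloring ?H m f" for f
  proof -
    have surj: "(\<lambda>i. f (Inl i)) ` {..<m} = {..<m}"
      using proper_coloring_two_cliques_inj[OF pc] by (intro endo_inj_surj) simp_all
    have "1 \<le> card {v \<in> pverts ?H. f v = c}" if "c < m" for c
    proof -
      have "c \<in> (\<lambda>i. f (Inl i)) ` {..<m}" using surj that by simp
      then obtain i where "i < m" "f (Inl i) = c" by auto
      then have "Inl i \<in> {v \<in> pverts ?H. f v = c}"
        by (simp add: disjoint_union_def complete_graph_def InlI)
      then have "{v \<in> pverts ?H. f v = c} \<noteq> {}" by blast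
      moreover have "finite {v \<in> pverts ?H. f v = c}" using fin by simp
      ultimately have "card {v \<in> pverts ?H. f v = c} \<noteq> 0" by (simp only: card_eq_0_iff) simp
      then show ?thesis by linarith
    qed
    then show ?thesis
      unfolding smallest_class_size_def using assms by (intro Min.boundedI) auto
  qed
  let ?f = "case_sum id id :: nat + nat \<Rightarrow> nat"
  \<comment> \<open>The smaller clique does not use the last color.\<close>
  have "{v \<in> pverts ?H. ?f v = m - 1} = {Inl (m - 1)}"
    using assms by (auto simp: disjoint_union_def complete_graph_def)
  then have "card {v \<in> pverts ?H. ?f v = m - 1} = 1" by simp
  moreover have "smallest_class_size ?H m ?f \<le> card {v \<in> pverts ?H. ?f v = m - 1}"
    unfolding smallest_class_size_def using assms by (intro Min_le) simp_all
  moreover have pc: "proper_coloring ?H m ?f"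
    using assms by (intro proper_coloring_two_cliques) simp
  ultimately have "smallest_class_size ?H m ?f = 1"
    using ge[of ?f] by linarith
  then have "\<exists>f. proper_coloring ?H m f \<and> 1 = smallest_class_size ?H m f"
    using pc by metis
  then show ?thesis
    unfolding chromatic_surplus_def chi using ge by (intro Least_equality) blast+
qed

section \<open>The Ramsey number\<close>

definition color_arcs :: "nat \<Rightarrow> (nat set \<Rightarrow> color) \<Rightarrow> color \<Rightarrow> (nat \<times> nat) set" where
  "color_arcs N c x = {(u, v). u < N \<and> v < N \<and> u \<noteq> v \<and> c {u, v} = x}"

lemma has_copy_color_subgraph_iff:
  assumes "pair_wf_digraph G"
  shows "has_copy G (color_subgraph (complete_graph N) c x) \<longleftrightarrow>
    embeds (pverts G) (parcs G) {..<N} (color_arcs N c x)"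
proof -
  have "pair_wf_digraph (complete_graph N)"
    by (rule pair_graph_imp_wf[OF pair_graph_complete_graph])
  then show ?thesis
    using has_copy_iff_embeds[OF assms pair_wf_color_subgraph, of "complete_graph N" c x]
    by (simp add: color_subgraph_def complete_graph_def color_arcs_def conj_assoc)
qed

lemma embeds_two_cliques:
  assumes "A \<subseteq> {..<N}" "B \<subseteq> {..<N}" "A \<inter> B = {}" "card A = m" "card B = l"
    and "indep (color_arcs N c Red) A" "indep (color_arcs N c Red) B"
  shows "embeds (pverts (two_cliques m l)) (parcs (two_cliques m l)) {..<N} (color_arcs N c Blue)"
proof -
  have blue: "(a, b) \<in> color_arcs N c Blue"
    if "indep (color_arcs N c Red) S" "S \<subseteq> {..<N}" "a \<in> S" "b \<in> S" "a \<noteq> b" for a b S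
    using that color.exhaust[of "c {a, b}"] by (auto simp: indep_def color_arcs_def)
  obtain g h where g: "bij_betw g {..<m} A" and h: "bij_betw h {..<l} B"
    using bij_betw_from_nat_into_finite[of A] bij_betw_from_nat_into_finite[of B] assms(1,2,4,5)
      finite_subset[OF _ finite_lessThan] by blast
  have gA: "g i \<in> A" if "i < m" for i using g that by (auto simp: bij_betw_def)
  have hB: "h i \<in> B" if "i < l" for i using h that by (auto simp: bij_betw_def)
  have gi: "g i \<noteq> g j" if "i < m" "j < m" "i \<noteq> j" for i j
    using g that by (auto simp: bij_betw_def inj_on_def)
  have hi: "h i \<noteq> h j" if "i < l" "j < l" "i \<noteq> j" for i j
    using h that by (auto simp: bij_betw_def inj_on_def)
  have V: "pverts (two_cliques m l) = {..<m} <+> {..<l}"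
    by (simp add: disjoint_union_def complete_graph_def)
  let ?f = "case_sum g h"
  have "inj_on ?f ({..<m} <+> {..<l})"
  proof (rule inj_onI)
    fix s t assume "s \<in> {..<m} <+> {..<l}" "t \<in> {..<m} <+> {..<l}" "?f s = ?f t"
    then show "s = t"
      using gA hB gi hi assms(3) by (cases s; cases t) fastforce+
  qed
  moreover have "?f ` ({..<m} <+> {..<l}) \<subseteq> {..<N}" using gA hB assms(1,2) by (auto simp: subset_iff)
  moreover have "(?f s, ?f t) \<in> color_arcs N c Blue" if "(s, t) \<in> parcs (two_cliques m l)" for s t
    using that gA hB gi hi blue[OF assms(6,1)] blue[OF assms(7,2)]
    by (auto simp: disjoint_union_def complete_graph_def)
  ultimately show ?thesis unfolding embeds_def V by (intro exI[of _ ?f]) blast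
qed

text \<open>
  The independent set of \<open>m\<close> vertices is the blue \<open>K\<^sub>m\<close>; the other one, on \<open>m - 1 \<ge> l\<close>
  vertices, contains the blue \<open>K\<^sub>l\<close>.
\<close>

lemma tree_arrows_two_cliques:
  assumes "undirected_tree T" "card (pverts T) \<ge> 3" "l < m"
  shows "ramsey_arrows ((card (pverts T) - 1) * (m - 1) + 1) T (two_cliques m l)"
  unfolding ramsey_arrows_def
proof
  fix c :: "nat set \<Rightarrow> color"
  let ?N = "(card (pverts T) - 1) * (m - 1) + 1"
  let ?R = "color_arcs ?N c Red"
  have wfT: "pair_wf_digraph T"
    using assms(1) by (simp add: undirected_tree_def pair_graph_imp_wf)
  have wfH: "pair_wf_digraph (two_cliques m l)"
    by (intro pair_graph_imp_wf pair_graph_disjoint_union pair_graph_complete_graph)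
  show "has_copy T (color_subgraph (complete_graph ?N) c Red) \<or>
      has_copy (two_cliques m l) (color_subgraph (complete_graph ?N) c Blue)"
    unfolding has_copy_color_subgraph_iff[OF wfT] has_copy_color_subgraph_iff[OF wfH]
  proof (intro disj_imp[THEN iffD2] impI)
    assume free: "\<not> embeds (pverts T) (parcs T) {..<?N} ?R"
    have R: "sym ?R" "irrefl ?R"
      by (auto simp: color_arcs_def sym_def irrefl_def insert_commute)
    have "(card (pverts T) - 1) * (m - 1) < card {..<?N}" by simp
    from tree_free_disjoint_indep_pair[OF undirected_tree_grown[OF assms(1)] assms(2) finite_lessThan R this free]
    obtain A B where AB: "A \<subseteq> {..<?N}" "B \<subseteq> {..<?N}" "A \<inter> B = {}"
        "indep ?R A" "indep ?R B" "card A = Suc (m - 1)" "card B = m - 1"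
      by blast
    have "l \<le> card B" using AB(7) assms(3) by simp
    then obtain B' where B': "B' \<subseteq> B" "card B' = l" using obtain_subset_with_card_n by metis
    show "embeds (pverts (two_cliques m l)) (parcs (two_cliques m l)) {..<?N} (color_arcs ?N c Blue)"
    proof (rule embeds_two_cliques)
      show "B' \<subseteq> {..<?N}" "A \<inter> B' = {}" using AB(2,3) B'(1) by blast+
      show "card A = m" using AB(6) assms(3) by simp
      show "indep ?R B'" using AB(5) B'(1) by (rule indep_subset)
    qed (fact AB B')+
  qed
qed

text \<open>
  Chvatal's extremal coloring: the red components are the blocks of \<open>s\<close> consecutive integers. Only
  its values on pairs matter.
\<close>

definition block_coloring :: "nat \<Rightarrow> nat set \<Rightarrow> color" where
  "block_coloring s e = (if \<exists>q. \<forall>u \<in> e. u div s = q then Red else Blue)"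

lemma block_coloring_pair: "block_coloring s {u, v} = Red \<longleftrightarrow> u div s = v div s"
  by (auto simp: block_coloring_def)

lemma grown_tree_constant:
  assumes "grown_tree V E" "\<And>a b. (a, b) \<in> E \<Longrightarrow> g a = g b" "a \<in> V" "b \<in> V"
  shows "g a = g b"
  using assms
proof (induction arbitrary: a b rule: grown_tree.induct)
  case (single v)
  then show ?case by simp
next
  case (add_leaf V E y x)
  have "g c = g y" if "c \<in> V" for c
    using add_leaf.IH[OF _ that add_leaf.hyps(2)] add_leaf.prems(1) by blast
  moreover have "g x = g y" using add_leaf.prems(1)[of x y] by blast
  ultimately show ?case using add_leaf.prems(2,3) by (metis insertE)
qed

text \<open>
  A red \<open>T\<close> would fit into one block, which has one vertex too few. A blue \<open>K\<^sub>m\<close> would have its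
  vertices in distinct blocks, but there are only \<open>m - 1\<close>.
\<close>

lemma not_arrows_two_cliques:
  assumes tree: "undirected_tree T" and n: "card (pverts T) \<ge> 2" and N: "N \<le> (card (pverts T) - 1) * (m - 1)"
    and m: "m \<ge> 1"
  shows "\<not> ramsey_arrows N T (two_cliques m l)"
proof
  define s where "s = card (pverts T) - 1"
  have s: "s > 0" "s < card (pverts T)" using n by (auto simp: s_def)
  let ?c = "block_coloring s"
  assume "ramsey_arrows N T (two_cliques m l)"
  then have copy: "has_copy T (color_subgraph (complete_graph N) ?c Red) \<or>
      has_copy (two_cliques m l) (color_subgraph (complete_graph N) ?c Blue)"
    by (simp add: ramsey_arrows_def)
  have wfT: "pair_wf_digraph T"
    using tree by (simp add: undirected_tree_def pair_graph_imp_wf)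
  have wfH: "pair_wf_digraph (two_cliques m l)"
    by (intro pair_graph_imp_wf pair_graph_disjoint_union pair_graph_complete_graph)
  have grown: "grown_tree (pverts T) (parcs T)" by (rule undirected_tree_grown[OF tree])
  from copy show False
    unfolding has_copy_color_subgraph_iff[OF wfT] has_copy_color_subgraph_iff[OF wfH]
  proof
    assume "embeds (pverts T) (parcs T) {..<N} (color_arcs N ?c Red)"
    then obtain f where f: "inj_on f (pverts T)" 
        "\<And>a b. (a, b) \<in> parcs T \<Longrightarrow> (f a, f b) \<in> color_arcs N ?c Red"
      by (auto simp: embeds_def)
    obtain r where r: "r \<in> pverts T" using grown_tree_nonempty[OF grown] by auto
    define q where "q = f r div s"
    have arc: "f a div s = f b div s" if "(a, b) \<in> parcs T" for a b
      using f(2)[OF that] by (simp add: color_arcs_def block_coloring_pair)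
    have "f a \<in> {q * s..<q * s + s}" if "a \<in> pverts T" for a
    proof -
      have "f a div s = q"
        unfolding q_def by (rule grown_tree_constant[OF grown arc that r])
      then have "f a = q * s + f a mod s" using div_mult_mod_eq[of "f a" s] by simp
      moreover have "f a mod s < s" using s by simp
      ultimately show ?thesis by (metis atLeastLessThan_iff le_add1 nat_add_left_cancel_less)
    qed
    then have "card (pverts T) \<le> card {q * s..<q * s + s}"
      by (intro card_inj_on_le[OF f(1)]) auto
    then show False using s by simp
  next
    assume "embeds (pverts (two_cliques m l)) (parcs (two_cliques m l)) {..<N} (color_arcs N ?c Blue)"
    then obtain f where f: "f ` pverts (two_cliques m l) \<subseteq> {..<N}"
        "\<And>a b. (a, b) \<in> parcs (two_cliques m l) \<Longrightarrow> (f a, f b) \<in> color_arcs N ?c Blue"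
      by (auto simp: embeds_def)
    let ?g = "\<lambda>i. f (Inl i) div s"
    have "?g i \<noteq> ?g j" if "i < m" "j < m" "i \<noteq> j" for i j
    proof -
      have "(Inl i, Inl j) \<in> parcs (two_cliques m l)"
        using that by (force simp: disjoint_union_def complete_graph_def)
      then have "?c {f (Inl i), f (Inl j)} \<noteq> Red" using f(2) by (fastforce simp: color_arcs_def)
      then show ?thesis by (simp add: block_coloring_pair)
    qed
    then have "inj_on ?g {..<m}" by (auto simp: inj_on_def)
    moreover have "?g i < m - 1" if "i < m" for i
    proof -
      have "Inl i \<in> pverts (two_cliques m l)"
        using that by (auto simp: disjoint_union_def complete_graph_def)
      then have "f (Inl i) < (m - 1) * s" using f(1) N by (force simp: s_def mult.commute)
      then show ?thesis by (simp add: less_mult_imp_div_less)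
    qed
    ultimately have "card {..<m} \<le> card {..<m - 1}" by (intro card_inj_on_le[of ?g]) auto
    then show False using m by simp
  qed
qed

theorem corollary3p2:
  fixes n m l :: nat and T :: "'a pair_pre_digraph"
  assumes "n \<ge> 3" and "m > l" and "l \<ge> 2"
    and "undirected_tree T" and "card (pverts T) = n"
  shows "is_good (disjoint_union (complete_graph m) (complete_graph l)) T"
proof -
  have "ramsey_number T (two_cliques m l) = (n - 1) * (m - 1) + 1"
    unfolding ramsey_number_def
  proof (rule Least_equality)
    show "ramsey_arrows ((n - 1) * (m - 1) + 1) T (two_cliques m l)"
      using tree_arrows_two_cliques[of T l m] assms by simp
  next
    fix N assume "ramsey_arrows N T (two_cliques m l)"
    then show "(n - 1) * (m - 1) + 1 \<le> N"
      using not_arrows_two_cliques[of T N m l] assms by force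
  qed
  then show ?thesis
    using assms pair_graph_disjoint_union[OF pair_graph_complete_graph pair_graph_complete_graph, of m l]
    by (simp add: is_good_def undirected_tree_def chromatic_number_two_cliques
        chromatic_surplus_two_cliques)
qed

end
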